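(* (Family $(0,-,3/2)$, Painlevé II, Flaschka--Newell form.) Let $\theta_0\in\mathbb{C}$, and let $p,q$ be holomorphic functions of $t$ on a connected open set $U\subset\mathbb{C}$ with $q$ avoiding $0$. Put $$A_0=\begin{pmatrix}p&\frac{p^2-\theta_0^2/4}q\\-q&-p\end{pmatrix},\quad A_1=\begin{pmatrix}0&q+t\\1&0\end{pmatrix},\quad A_2=\begin{pmatrix}0&1\\0&0\end{pmatrix},\quad B=\begin{pmatrix}0&2q+t\\1&0\end{pmatrix}+z\begin{pmatrix}0&1\\0&0\end{pmatrix}.$$ Then the operators $\frac{d}{dz}+\frac1zA_0+A_1+zA_2$ and $\frac{d}{dt}+B$ commute if and only if $$\frac{dq}{dt}=2p,\qquad\frac{dp}{dt}=2q^2+tq+\frac{p^2-\theta_0^2/4}q .$$ This system is the Hamiltonian system $\frac{dq}{dt}=-q\frac{\partial H}{\partial p}$, $\frac{dp}{dt}=q\frac{\partial H}{\partial q}$ with $$H=-\frac{p^2-\theta_0^2/4}q+q^2+tq,$$ and, with $p=\frac12q'$, it is equivalent to $$q''=\frac{(q')^2}{2q}+4q^2+2tq-\frac{\theta_0^2}{2q}.$$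
   Context: Operators act on vector-valued functions of $(z,t)$; $\frac{d}{dz},\frac{d}{dt}$ are the partial derivatives. Two operators $\frac{d}{dz}+A$ and $\frac{d}{dt}+B$ with matrix functions $A(z,t),B(z,t)$ commute iff $\frac{\partial A}{\partial t}=\frac{\partial B}{\partial z}+AB-BA$ identically in $z,t$. In the Hamiltonian equations $H=H(p,q,t)$ with partial derivatives in the independent variables $p,q,t$; $'$ denotes $\frac{d}{dt}$. (This commutation is the isomonodromy condition for the family of connections.) *)

theory Defs
  imports "HOL-Analysis.Analysis"
begin

section \<open>Linear differential operators in two complex variables\<close>

text \<open>A vector-valued function of \<open>(z, t)\<close> is a function on \<open>complex \<times> complex\<close>.
  It is holomorphic on an open set if at every point it has a complex-linear Frechet derivative.\<close>

definition holomorphic2_on :: "(complex \<times> complex \<Rightarrow> complex ^ 'n) \<Rightarrow> (complex \<times> complex) set \<Rightarrow> bool"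
    (infixl "holomorphic2'_on" 50) where
  "Y holomorphic2_on W \<longleftrightarrow>
     (\<forall>x\<in>W. \<exists>Y'. (Y has_derivative Y') (at x) \<and>
        (\<forall>c u v. Y' (c * u, c * v) = c *s Y' (u, v)))"

definition pdz :: "(complex \<times> complex \<Rightarrow> complex ^ 'n) \<Rightarrow> complex \<times> complex \<Rightarrow> complex ^ 'n" where
  "pdz Y = (\<lambda>(z, t). \<chi> i. deriv (\<lambda>w. Y (w, t) $ i) z)"

definition pdt :: "(complex \<times> complex \<Rightarrow> complex ^ 'n) \<Rightarrow> complex \<times> complex \<Rightarrow> complex ^ 'n" where
  "pdt Y = (\<lambda>(z, t). \<chi> i. deriv (\<lambda>s. Y (z, s) $ i) t)"

text \<open>The operators \<open>d/dz + A\<close> and \<open>d/dt + B\<close>.\<close>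

definition dz_op :: "(complex \<Rightarrow> complex \<Rightarrow> complex ^ 'n ^ 'n)
    \<Rightarrow> (complex \<times> complex \<Rightarrow> complex ^ 'n) \<Rightarrow> complex \<times> complex \<Rightarrow> complex ^ 'n" where
  "dz_op A Y = (\<lambda>(z, t). pdz Y (z, t) + A z t *v Y (z, t))"

definition dt_op :: "(complex \<Rightarrow> complex \<Rightarrow> complex ^ 'n ^ 'n)
    \<Rightarrow> (complex \<times> complex \<Rightarrow> complex ^ 'n) \<Rightarrow> complex \<times> complex \<Rightarrow> complex ^ 'n" where
  "dt_op B Y = (\<lambda>(z, t). pdt Y (z, t) + B z t *v Y (z, t))"

text \<open>Commutation over an open set \<open>D\<close>: the operators act on vector functions that are
  holomorphic on arbitrary open subsets of \<open>D\<close> (sections of the sheaf of holomorphic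
  vector functions), and not only on those that extend to all of \<open>D\<close>.\<close>

definition commute_on ::
  "(complex \<times> complex) set
    \<Rightarrow> ((complex \<times> complex \<Rightarrow> complex ^ 'n) \<Rightarrow> complex \<times> complex \<Rightarrow> complex ^ 'n)
    \<Rightarrow> ((complex \<times> complex \<Rightarrow> complex ^ 'n) \<Rightarrow> complex \<times> complex \<Rightarrow> complex ^ 'n) \<Rightarrow> bool" where
  "commute_on D L M \<longleftrightarrow>
     (\<forall>W Y. open W \<and> W \<subseteq> D \<and> Y holomorphic2_on W \<longrightarrow> (\<forall>x\<in>W. L (M Y) x = M (L Y) x))"

section \<open>The Flaschka--Newell family\<close>

definition mat22 :: "complex \<Rightarrow> complex \<Rightarrow> complex \<Rightarrow> complex \<Rightarrow> complex ^ 2 ^ 2" where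
  "mat22 a b c d = vector [vector [a, b], vector [c, d]]"

text \<open>The matrices as functions of the values \<open>p\<close>, \<open>q\<close> and of \<open>t\<close>; \<open>\<theta>\<close> stands for \<open>\<theta>\<^sub>0\<close>.\<close>

definition FN_A0 :: "complex \<Rightarrow> complex \<Rightarrow> complex \<Rightarrow> complex ^ 2 ^ 2" where
  "FN_A0 \<theta> p q = mat22 p ((p\<^sup>2 - \<theta>\<^sup>2 / 4) / q) (- q) (- p)"

definition FN_A1 :: "complex \<Rightarrow> complex \<Rightarrow> complex ^ 2 ^ 2" where
  "FN_A1 q t = mat22 0 (q + t) 1 0"

definition FN_A2 :: "complex ^ 2 ^ 2" where
  "FN_A2 = mat22 0 1 0 0"

definition FN_A :: "complex \<Rightarrow> (complex \<Rightarrow> complex) \<Rightarrow> (complex \<Rightarrow> complex)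
    \<Rightarrow> complex \<Rightarrow> complex \<Rightarrow> complex ^ 2 ^ 2" where
  "FN_A \<theta> p q z t =
     map_matrix (\<lambda>a. 1 / z * a) (FN_A0 \<theta> (p t) (q t)) + FN_A1 (q t) t + map_matrix (\<lambda>a. z * a) FN_A2"

definition FN_B :: "(complex \<Rightarrow> complex) \<Rightarrow> complex \<Rightarrow> complex \<Rightarrow> complex ^ 2 ^ 2" where
  "FN_B q z t = mat22 0 (2 * q t + t) 1 0 + map_matrix (\<lambda>a. z * a) (mat22 0 1 0 0)"

definition FN_system :: "complex \<Rightarrow> complex set \<Rightarrow> (complex \<Rightarrow> complex) \<Rightarrow> (complex \<Rightarrow> complex) \<Rightarrow> bool" where
  "FN_system \<theta> U p q \<longleftrightarrow>
     (\<forall>t\<in>U. deriv q t = 2 * p t \<and>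
            deriv p t = 2 * (q t)\<^sup>2 + t * q t + ((p t)\<^sup>2 - \<theta>\<^sup>2 / 4) / q t)"

definition FN_H :: "complex \<Rightarrow> complex \<Rightarrow> complex \<Rightarrow> complex \<Rightarrow> complex" where
  "FN_H \<theta> p q t = - ((p\<^sup>2 - \<theta>\<^sup>2 / 4) / q) + q\<^sup>2 + t * q"

text \<open>The right-hand sides of the Hamiltonian equations \<open>q' = - q \<partial>H/\<partial>p\<close>, \<open>p' = q \<partial>H/\<partial>q\<close>
  (note the extra factor \<open>q\<close> and the signs), for \<open>H = H(p, q, t)\<close> with
  independent variables \<open>p\<close>, \<open>q\<close>, \<open>t\<close>.\<close>

definition ham_q :: "(complex \<Rightarrow> complex \<Rightarrow> complex \<Rightarrow> complex) \<Rightarrow> complex \<Rightarrow> complex \<Rightarrow> complex \<Rightarrow> complex" where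
  "ham_q H p q t = - q * deriv (\<lambda>x. H x q t) p"

definition ham_p :: "(complex \<Rightarrow> complex \<Rightarrow> complex \<Rightarrow> complex) \<Rightarrow> complex \<Rightarrow> complex \<Rightarrow> complex \<Rightarrow> complex" where
  "ham_p H p q t = q * deriv (\<lambda>y. H p y t) q"

definition hamiltonian_system :: "(complex \<Rightarrow> complex \<Rightarrow> complex \<Rightarrow> complex)
    \<Rightarrow> complex set \<Rightarrow> (complex \<Rightarrow> complex) \<Rightarrow> (complex \<Rightarrow> complex) \<Rightarrow> bool" where
  "hamiltonian_system H U p q \<longleftrightarrow>
     (\<forall>t\<in>U. deriv q t = ham_q H (p t) (q t) t \<and> deriv p t = ham_p H (p t) (q t) t)"

definition PII_equation :: "complex \<Rightarrow> complex set \<Rightarrow> (complex \<Rightarrow> complex) \<Rightarrow> bool" where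
  "PII_equation \<theta> U q \<longleftrightarrow>
     (\<forall>t\<in>U. deriv (deriv q) t =
        (deriv q t)\<^sup>2 / (2 * q t) + 4 * (q t)\<^sup>2 + 2 * t * q t - \<theta>\<^sup>2 / (2 * q t))"

end

theory Submission
  imports Defs "HOL-Complex_Analysis.Cauchy_Integral_Formula"
begin

text \<open>
  The commutator of \<open>d/dz + A\<close> and \<open>d/dt + B\<close> is multiplication by the matrix
  \<open>B\<^sub>z - A\<^sub>t + AB - BA\<close>, because mixed partial derivatives of holomorphic functions commute.
  Testing on constant vectors shows that the operators commute iff this matrix vanishes.
  For the Flaschka--Newell matrices the diagonal and lower left entries of the resulting equation
  are exactly the two differential equations, and the upper right entry follows from them.
\<close>

section \<open>Symmetry of mixed partial derivatives in two complex variables\<close>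

text \<open>
  The difference quotients in \<open>t\<close> converge uniformly in \<open>z\<close>, by Taylor's formula and Cauchy's
  estimate for the second derivative; so their \<open>z\<close>-derivatives converge to that of the limit.
\<close>
lemma mixed_partials:
  fixes f :: "complex \<times> complex \<Rightarrow> complex"
  assumes "open W" "(z, t) \<in> W" and cont: "continuous_on W f"
    and dz: "\<And>w s. (w, s) \<in> W \<Longrightarrow> (\<lambda>w. f (w, s)) field_differentiable at w"
    and dt: "\<And>w s. (w, s) \<in> W \<Longrightarrow> (\<lambda>s. f (w, s)) field_differentiable at s"
  obtains d where "((\<lambda>w. deriv (\<lambda>s. f (w, s)) t) has_field_derivative d) (at z)"
    and "((\<lambda>s. deriv (\<lambda>w. f (w, s)) z) has_field_derivative d) (at t)"
proof -
  obtain A B where AB: "open A" "open B" "(z, t) \<in> A \<times> B" "A \<times> B \<subseteq> W"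
    using open_prod_elim[OF assms(1,2)] by metis
  obtain r1 where r1: "r1 > 0" "cball z r1 \<subseteq> A"
    using AB open_contains_cball by (metis mem_Sigma_iff)
  obtain r2 where r2: "r2 > 0" "cball t r2 \<subseteq> B"
    using AB open_contains_cball by (metis mem_Sigma_iff)
  define r where "r = min r1 r2 / 2"
  have r: "r > 0" "r + r \<le> r1" "r + r \<le> r2"
    using r1 r2 by (auto simp: r_def)
  have sub: "cball z (r + r) \<times> cball t (r + r) \<subseteq> W"
  proof -
    have "cball z (r + r) \<subseteq> A" "cball t (r + r) \<subseteq> B"
      using r r1 r2 by (auto intro: order_trans)
    then show ?thesis using AB(4) by blast
  qed
  \<comment> \<open>Joint continuity on a compact bidisc yields a single bound \<open>M\<close> for
    all slices, so the estimates below are uniform in \<open>w\<close>.\<close>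
  have "bounded (f ` (cball z (r + r) \<times> cball t (r + r)))"
    by (intro compact_imp_bounded compact_continuous_image compact_Times compact_cball
        continuous_on_subset[OF cont sub])
  then obtain M where M: "\<And>w s. w \<in> cball z (r + r) \<Longrightarrow> s \<in> cball t (r + r) \<Longrightarrow> norm (f (w, s)) \<le> M"
    unfolding bounded_iff by blast
  define C where "C = fact 2 * (M + 1) / r ^ 2"
  have Wz: "(w, s) \<in> W" if "w \<in> cball z r" "s \<in> cball t (r + r)" for w s
    using that r(1) by (intro subsetD[OF sub]) auto
  have quot: "norm ((f (w, t + h) - f (w, t)) / h - deriv (\<lambda>s. f (w, s)) t) \<le> C * norm h"
    if w: "w \<in> cball z r" and h: "norm h < r" "h \<noteq> 0" for w h
  proof -
    let ?g = "\<lambda>s. f (w, s)"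
    have hol: "?g holomorphic_on ball t (r + r)"
      unfolding holomorphic_on_def
      using Wz[OF w] by (auto intro!: field_differentiable_at_within dt)
    have gC: "norm ((deriv ^^ 2) ?g x) \<le> C" if x: "x \<in> ball t r" for x
    proof -
      have sb: "cball x r \<subseteq> ball t (r + r)"
      proof
        fix y assume "y \<in> cball x r"
        then show "y \<in> ball t (r + r)"
          using x dist_triangle[of t y x] by simp
      qed
      have "norm ((deriv ^^ 2) ?g x) \<le> fact 2 * (M + 1) / r ^ 2"
      proof (rule Cauchy_higher_deriv_bound[where y = 0])
        show "?g holomorphic_on ball x r"
          using hol sb by (meson ball_subset_cball holomorphic_on_subset subset_trans)
        show "continuous_on (cball x r) ?g"
          using hol sb holomorphic_on_imp_continuous_on continuous_on_subset by blast
        fix s assume "s \<in> ball x r"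
        then have "s \<in> cball t (r + r)" using sb ball_subset_cball by (meson subsetD)
        moreover have "w \<in> cball z (r + r)" using w r(1) by auto
        ultimately have "norm (f (w, s)) \<le> M" by (intro M)
        then show "f (w, s) \<in> ball 0 (M + 1)" by simp
      qed (use r in auto)
      then show ?thesis by (simp add: C_def)
    qed
    \<comment> \<open>First-order Taylor expansion at \<open>t\<close>: the remainder is quadratic
      in \<open>h\<close>, so dividing by \<open>h\<close> leaves an error of at most
      \<open>C * norm h\<close>.\<close>
    have "norm (((deriv ^^ 0) ?g) (t + h) - (\<Sum>i\<le>1. (deriv ^^ i) ?g t * (t + h - t) ^ i / fact i))
          \<le> C * norm (t + h - t) ^ Suc 1 / fact 1"
    proof (rule complex_Taylor[where S = "ball t r"])
      fix i :: nat and x assume "x \<in> ball t r"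
      then have "x \<in> ball t (r + r)" using r(1) by auto
      then show "((deriv ^^ i) ?g has_field_derivative (deriv ^^ Suc i) ?g x) (at x within ball t r)"
        using has_field_derivative_higher_deriv[OF hol open_ball] has_field_derivative_at_within by blast
    next
      fix x assume "x \<in> ball t r"
      then show "norm ((deriv ^^ Suc 1) ?g x) \<le> C" using gC by (simp add: numeral_2_eq_2)
    qed (use h r in \<open>auto simp: dist_norm\<close>)
    then have *: "norm (f (w, t + h) - f (w, t) - deriv ?g t * h) \<le> C * norm h * norm h"
      by (simp add: power2_eq_square algebra_simps)
    have "norm ((f (w, t + h) - f (w, t)) / h - deriv ?g t)
        = norm (f (w, t + h) - f (w, t) - deriv ?g t * h) / norm h"
      using h by (simp add: norm_divide[symmetric] diff_divide_distrib)
    also have "\<dots> \<le> C * norm h"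
      using * h by (simp add: divide_le_eq)
    finally show ?thesis .
  qed
  have small: "\<forall>\<^sub>F h in at 0. norm h < e \<and> h \<noteq> 0" if "e > 0" for e :: real
    using that unfolding eventually_at by (intro exI[of _ e]) (auto simp: dist_norm)
  have ulim: "uniform_limit (cball z r) (\<lambda>h w. (f (w, t + h) - f (w, t)) / h)
      (\<lambda>w. deriv (\<lambda>s. f (w, s)) t) (at 0)"
  proof (rule uniform_limitI)
    fix e :: real assume "e > 0"
    have "norm (f (z, t)) \<le> M" using M r(1) by simp
    then have "M \<ge> 0" using norm_ge_zero order_trans by blast
    then have "C \<ge> 0" by (simp add: C_def)
    then have "0 < e / (C + 1)" using \<open>e > 0\<close> by simp
    from small[OF this] small[OF r(1)]
    show "\<forall>\<^sub>F h in at 0. \<forall>w\<in>cball z r.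
        dist ((f (w, t + h) - f (w, t)) / h) (deriv (\<lambda>s. f (w, s)) t) < e"
    proof eventually_elim
      case (elim h)
      have "C * norm h \<le> (C + 1) * norm h" by (simp add: algebra_simps)
      also have "\<dots> < e" using elim \<open>C \<ge> 0\<close> by (simp add: field_simps)
      finally show ?case using quot elim unfolding dist_norm by (meson order_le_less_trans)
    qed
  qed
  \<comment> \<open>The \<open>w\<close>-derivative of a difference quotient in \<open>t\<close> is
    the difference quotient in \<open>t\<close> of the \<open>w\<close>-derivative. Once limits and
    \<open>w\<close>-derivatives are interchanged, the limit of the latter is by definition a mixed
    partial derivative.\<close>
  have ev: "\<forall>\<^sub>F h in at 0. continuous_on (cball z r) (\<lambda>w. (f (w, t + h) - f (w, t)) / h) \<and>
      (\<forall>w\<in>ball z r. ((\<lambda>w. (f (w, t + h) - f (w, t)) / h) has_field_derivative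
         (deriv (\<lambda>w. f (w, t + h)) w - deriv (\<lambda>w. f (w, t)) w) / h) (at w))"
    using small[OF r(1)]
  proof eventually_elim
    case (elim h)
    have D: "((\<lambda>w. (f (w, t + h) - f (w, t)) / h) has_field_derivative
         (deriv (\<lambda>w. f (w, t + h)) w - deriv (\<lambda>w. f (w, t)) w) / h) (at w)"
      if "w \<in> cball z r" for w
    proof -
      have "(w, t + h) \<in> W" "(w, t) \<in> W"
        using Wz[OF that] elim r(1) by (auto simp: dist_norm)
      then show ?thesis
        using elim by (auto intro!: DERIV_cdivide DERIV_diff dz simp: DERIV_deriv_iff_field_differentiable)
    qed
    then show ?case
      by (auto intro!: continuous_at_imp_continuous_on DERIV_isCont)
  qed
  obtain g' where g': "\<And>w. w \<in> ball z r \<Longrightarrow>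
      ((\<lambda>w. deriv (\<lambda>s. f (w, s)) t) has_field_derivative g' w) (at w) \<and>
      ((\<lambda>h. (deriv (\<lambda>w. f (w, t + h)) w - deriv (\<lambda>w. f (w, t)) w) / h) \<longlongrightarrow> g' w) (at 0)"
    by (rule has_complex_derivative_uniform_limit[OF ev ulim _ r(1)]) auto
  show thesis
    using g'[of z] r(1) by (intro that[of "g' z"]) (auto simp: DERIV_def)
qed

section \<open>The commutator and the zero-curvature equation\<close>

text \<open>Composing with the coordinate embeddings restricts the Frechet derivative to each axis.
  Its complex linearity makes each restriction multiplication by a complex number, so the components
  satisfy the hypotheses of \<open>mixed_partials\<close>.\<close>

lemma holomorphic2_componentD:
  fixes Y :: "complex \<times> complex \<Rightarrow> complex ^ 'n"
  assumes "Y holomorphic2_on W" "(z, t) \<in> W"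
  shows "continuous (at (z, t)) (\<lambda>x. Y x $ i)"
    and "(\<lambda>w. Y (w, t) $ i) field_differentiable at z"
    and "(\<lambda>s. Y (z, s) $ i) field_differentiable at t"
proof -
  obtain Y' where Y': "(Y has_derivative Y') (at (z, t))"
    and lin: "\<And>c u v. Y' (c * u, c * v) = c *s Y' (u, v)"
    using assms unfolding holomorphic2_on_def by blast
  have f: "((\<lambda>x. Y x $ i) has_derivative (\<lambda>h. Y' h $ i)) (at (z, t))"
    by (rule bounded_linear.has_derivative[OF bounded_linear_vec_nth Y'])
  show "continuous (at (z, t)) (\<lambda>x. Y x $ i)"
    using f by (rule has_derivative_continuous)
  have "((\<lambda>w. Y (w, t) $ i) has_derivative (\<lambda>h. Y' (h, 0) $ i)) (at z)"
    by (rule has_derivative_compose[where f = "\<lambda>w. (w, t)" and g = "\<lambda>x. Y x $ i", OF _ f])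
      (auto intro!: derivative_eq_intros)
  moreover have "(\<lambda>h. Y' (h, 0) $ i) = (*) (Y' (1, 0) $ i)"
  proof
    fix h show "Y' (h, 0) $ i = Y' (1, 0) $ i * h"
      using lin[of h 1 0] by (simp add: mult.commute)
  qed
  ultimately show "(\<lambda>w. Y (w, t) $ i) field_differentiable at z"
    unfolding field_differentiable_def has_field_derivative_def by metis
  have "((\<lambda>s. Y (z, s) $ i) has_derivative (\<lambda>h. Y' (0, h) $ i)) (at t)"
    by (rule has_derivative_compose[where f = "\<lambda>s. (z, s)" and g = "\<lambda>x. Y x $ i", OF _ f])
      (auto intro!: derivative_eq_intros)
  moreover have "(\<lambda>h. Y' (0, h) $ i) = (*) (Y' (0, 1) $ i)"
  proof
    fix h show "Y' (0, h) $ i = Y' (0, 1) $ i * h"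
      using lin[of h 0 1] by (simp add: mult.commute)
  qed
  ultimately show "(\<lambda>s. Y (z, s) $ i) field_differentiable at t"
    unfolding field_differentiable_def has_field_derivative_def by metis
qed

text \<open>By the product rule the terms \<open>A z t *v pdt Y (z, t)\<close> and
  \<open>B z t *v pdz Y (z, t)\<close> appear in both compositions and cancel, as do the mixed
  second derivatives. Only terms of order zero in \<open>Y\<close> survive.\<close>

lemma commutator_eq_curvature:
  fixes A B :: "complex \<Rightarrow> complex \<Rightarrow> complex ^ 'n ^ 'n"
  assumes "open W" "Y holomorphic2_on W" "(z, t) \<in> W"
    and A: "\<And>i j. ((\<lambda>s. A z s $ i $ j) has_field_derivative A' $ i $ j) (at t)"
    and B: "\<And>i j. ((\<lambda>w. B w t $ i $ j) has_field_derivative B' $ i $ j) (at z)"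
  shows "dz_op A (dt_op B Y) (z, t) - dt_op B (dz_op A Y) (z, t)
    = (B' + A z t ** B z t - B z t ** A z t - A') *v Y (z, t)"
proof (rule vec_eq_iff[THEN iffD2], rule allI)
  fix i
  note Y = holomorphic2_componentD[OF assms(2)]
  have "continuous_on W (\<lambda>x. Y x $ i)"
    by (intro continuous_at_imp_continuous_on ballI) (metis Y(1) prod.collapse)
  \<comment> \<open>One number \<open>d\<close> serves as both mixed derivatives of the component,
    which is what makes it cancel in the difference.\<close>
  then obtain d where
    d: "((\<lambda>w. deriv (\<lambda>s. Y (w, s) $ i) t) has_field_derivative d) (at z)"
      "((\<lambda>s. deriv (\<lambda>w. Y (w, s) $ i) z) has_field_derivative d) (at t)"
    using mixed_partials[OF assms(1,3), of "\<lambda>x. Y x $ i"] Y(2,3) by blast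
  have "((\<lambda>w. dt_op B Y (w, t) $ i) has_field_derivative
      d + (\<Sum>j\<in>UNIV. B' $ i $ j * Y (z, t) $ j + deriv (\<lambda>w. Y (w, t) $ j) z * B z t $ i $ j)) (at z)"
    unfolding dt_op_def pdt_def
    by (auto simp: matrix_vector_mult_def DERIV_deriv_iff_field_differentiable
        intro!: DERIV_add DERIV_sum DERIV_mult d B Y(2) assms(3))
  then have 1: "pdz (dt_op B Y) (z, t) $ i =
      d + (\<Sum>j\<in>UNIV. B' $ i $ j * Y (z, t) $ j + deriv (\<lambda>w. Y (w, t) $ j) z * B z t $ i $ j)"
    unfolding pdz_def by (simp add: DERIV_imp_deriv)
  have "((\<lambda>s. dz_op A Y (z, s) $ i) has_field_derivative
      d + (\<Sum>j\<in>UNIV. A' $ i $ j * Y (z, t) $ j + deriv (\<lambda>s. Y (z, s) $ j) t * A z t $ i $ j)) (at t)"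
    unfolding dz_op_def pdz_def
    by (auto simp: matrix_vector_mult_def DERIV_deriv_iff_field_differentiable
        intro!: DERIV_add DERIV_sum DERIV_mult d A Y(3) assms(3))
  then have 2: "pdt (dz_op A Y) (z, t) $ i =
      d + (\<Sum>j\<in>UNIV. A' $ i $ j * Y (z, t) $ j + deriv (\<lambda>s. Y (z, s) $ j) t * A z t $ i $ j)"
    unfolding pdt_def by (simp add: DERIV_imp_deriv)
  have 3: "pdz (dt_op B Y) (z, t) $ i = d + (B' *v Y (z, t)) $ i + (B z t *v pdz Y (z, t)) $ i"
    unfolding 1 by (simp add: matrix_vector_mult_def pdz_def sum.distrib mult.commute)
  have 4: "pdt (dz_op A Y) (z, t) $ i = d + (A' *v Y (z, t)) $ i + (A z t *v pdt Y (z, t)) $ i"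
    unfolding 2 by (simp add: matrix_vector_mult_def pdt_def sum.distrib mult.commute)
  have "(dz_op A (dt_op B Y) (z, t) - dt_op B (dz_op A Y) (z, t)) $ i
      = pdz (dt_op B Y) (z, t) $ i - pdt (dz_op A Y) (z, t) $ i
        + (A z t *v (pdt Y (z, t) + B z t *v Y (z, t))) $ i
        - (B z t *v (pdz Y (z, t) + A z t *v Y (z, t))) $ i"
    by (simp add: dz_op_def dt_op_def)
  also have "\<dots> = ((B' + A z t ** B z t - B z t ** A z t - A') *v Y (z, t)) $ i"
    unfolding 3 4 by (simp add: matrix_vector_right_distrib matrix_vector_mult_add_rdistrib
        matrix_vector_mult_diff_rdistrib matrix_vector_mul_assoc)
  finally show "(dz_op A (dt_op B Y) (z, t) - dt_op B (dz_op A Y) (z, t)) $ i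
      = ((B' + A z t ** B z t - B z t ** A z t - A') *v Y (z, t)) $ i" .
qed

lemma holomorphic2_on_const: "(\<lambda>_. c) holomorphic2_on W"
  unfolding holomorphic2_on_def by (auto intro!: exI[of _ "\<lambda>_. 0"])

text \<open>Since the commutator is multiplication by a matrix, constant fields on all of
  \<open>D\<close> already detect it, while its vanishing settles every local field
  pointwise.\<close>

lemma commute_on_iff_zero_curvature:
  fixes A B A' B' :: "complex \<Rightarrow> complex \<Rightarrow> complex ^ 'n ^ 'n"
  assumes "open D"
    and A: "\<And>z t i j. (z, t) \<in> D \<Longrightarrow> ((\<lambda>s. A z s $ i $ j) has_field_derivative A' z t $ i $ j) (at t)"
    and B: "\<And>z t i j. (z, t) \<in> D \<Longrightarrow> ((\<lambda>w. B w t $ i $ j) has_field_derivative B' z t $ i $ j) (at z)"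
  shows "commute_on D (dz_op A) (dt_op B) \<longleftrightarrow>
    (\<forall>(z, t)\<in>D. A' z t = B' z t + A z t ** B z t - B z t ** A z t)"
proof -
  have eq: "dz_op A (dt_op B Y) (z, t) = dt_op B (dz_op A Y) (z, t) \<longleftrightarrow>
      (B' z t + A z t ** B z t - B z t ** A z t) *v Y (z, t) = A' z t *v Y (z, t)"
    if "open W" "W \<subseteq> D" "Y holomorphic2_on W" "(z, t) \<in> W" for W Y z t
  proof -
    have zt: "(z, t) \<in> D" using that(2,4) by blast
    have "dz_op A (dt_op B Y) (z, t) - dt_op B (dz_op A Y) (z, t)
        = (B' z t + A z t ** B z t - B z t ** A z t) *v Y (z, t) - A' z t *v Y (z, t)"
      unfolding commutator_eq_curvature[where A = A and B = B and A' = "A' z t" and B' = "B' z t",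
          OF that(1,3,4) A[OF zt] B[OF zt]]
      by (rule matrix_vector_mult_diff_rdistrib)
    then show ?thesis by (metis eq_iff_diff_eq_0)
  qed
  show ?thesis
  proof
    assume L: "commute_on D (dz_op A) (dt_op B)"
    show "\<forall>(z, t)\<in>D. A' z t = B' z t + A z t ** B z t - B z t ** A z t"
    proof clarify
      fix z t assume zt: "(z, t) \<in> D"
      have "A' z t *v c = (B' z t + A z t ** B z t - B z t ** A z t) *v c" for c
      proof -
        have "dz_op A (dt_op B (\<lambda>_. c)) (z, t) = dt_op B (dz_op A (\<lambda>_. c)) (z, t)"
          using L assms(1) zt holomorphic2_on_const unfolding commute_on_def by blast
        then show ?thesis
          using eq[OF assms(1) subset_refl holomorphic2_on_const zt] by simp
      qed
      then show "A' z t = B' z t + A z t ** B z t - B z t ** A z t"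
        by (simp add: matrix_eq)
    qed
  next
    assume "\<forall>(z, t)\<in>D. A' z t = B' z t + A z t ** B z t - B z t ** A z t"
    then show "commute_on D (dz_op A) (dt_op B)"
      unfolding commute_on_def using eq by fastforce
  qed
qed

section \<open>Hamiltonian form and reduction to Painleve II\<close>

lemma ham_q_FN:
  assumes "Q \<noteq> 0"
  shows "ham_q (FN_H \<theta>) P Q t = 2 * P"
proof -
  have "((\<lambda>x. FN_H \<theta> x Q t) has_field_derivative - (2 * P / Q)) (at P)"
    unfolding FN_H_def using assms by (auto intro!: derivative_eq_intros)
  then show ?thesis unfolding ham_q_def using assms by (simp add: DERIV_imp_deriv)
qed

lemma ham_p_FN:
  assumes "Q \<noteq> 0"
  shows "ham_p (FN_H \<theta>) P Q t = 2 * Q\<^sup>2 + t * Q + (P\<^sup>2 - \<theta>\<^sup>2 / 4) / Q"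
proof -
  have "((\<lambda>y. FN_H \<theta> P y t) has_field_derivative (P\<^sup>2 - \<theta>\<^sup>2 / 4) / (Q * Q) + 2 * Q + t) (at Q)"
    unfolding FN_H_def using assms by (auto intro!: derivative_eq_intros simp: minus_divide_left)
  then have "deriv (\<lambda>y. FN_H \<theta> P y t) Q = (P\<^sup>2 - \<theta>\<^sup>2 / 4) / (Q * Q) + 2 * Q + t"
    by (rule DERIV_imp_deriv)
  then show ?thesis unfolding ham_p_def using assms
    by (simp add: distrib_left power2_eq_square)
qed

lemma FN_system_iff_hamiltonian:
  assumes "\<And>t. t \<in> U \<Longrightarrow> q t \<noteq> 0"
  shows "FN_system \<theta> U p q \<longleftrightarrow> hamiltonian_system (FN_H \<theta>) U p q"
  using assms by (simp add: FN_system_def hamiltonian_system_def ham_q_FN ham_p_FN)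

text \<open>The first equation determines \<open>p\<close> as half of \<open>deriv q\<close>;
  eliminating \<open>p\<close> from the second equation and doubling gives the scalar
  equation.\<close>

lemma FN_system_iff_PII:
  assumes "open U" "q holomorphic_on U" and q0: "\<And>t. t \<in> U \<Longrightarrow> q t \<noteq> 0"
  shows "FN_system \<theta> U p q \<longleftrightarrow> (\<forall>t\<in>U. p t = 1 / 2 * deriv q t) \<and> PII_equation \<theta> U q"
proof -
  have dp: "deriv p t = deriv (deriv q) t / 2" if p: "\<forall>t\<in>U. p t = 1 / 2 * deriv q t" and t: "t \<in> U" for t
  proof -
    \<comment> \<open>An equality at \<open>t\<close> alone could not be differentiated; openness of
      \<open>U\<close> makes it hold near \<open>t\<close>.\<close>
    have "\<forall>\<^sub>F s in nhds t. p s = deriv q s / 2"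
      using assms(1) t p by (auto simp: eventually_nhds)
    then have "deriv p t = deriv (\<lambda>s. deriv q s / 2) t" by (rule deriv_cong_ev) simp
    moreover have "(deriv q has_field_derivative deriv (deriv q) t) (at t)"
      using holomorphic_deriv[OF assms(2,1)] assms(1) t holomorphic_derivI by blast
    ultimately show ?thesis by (metis DERIV_cdivide DERIV_imp_deriv)
  qed
  have "deriv q t = 2 * p t \<longleftrightarrow> p t = 1 / 2 * deriv q t" for t
    by (auto simp: field_simps)
  moreover have "(deriv p t = 2 * (q t)\<^sup>2 + t * q t + ((p t)\<^sup>2 - \<theta>\<^sup>2 / 4) / q t) \<longleftrightarrow>
      (deriv (deriv q) t = (deriv q t)\<^sup>2 / (2 * q t) + 4 * (q t)\<^sup>2 + 2 * t * q t - \<theta>\<^sup>2 / (2 * q t))"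
    if "\<forall>t\<in>U. p t = 1 / 2 * deriv q t" "t \<in> U" for t
  proof -
    have "((p t)\<^sup>2 - \<theta>\<^sup>2 / 4) / q t = ((deriv q t)\<^sup>2 / (2 * q t) - \<theta>\<^sup>2 / (2 * q t)) / 2"
      using q0[OF that(2)] unfolding bspec[OF that] by (simp add: field_simps power2_eq_square)
    \<comment> \<open>Here \<open>a\<close> and \<open>b\<close> stand for the two quotients by
      \<open>2 * q t\<close>, and \<open>x\<close>, \<open>y\<close>, \<open>u\<close> for the
      second derivative, \<open>(q t)\<^sup>2\<close> and \<open>t * q t\<close>; the claim becomes
      linear.\<close>
    moreover have "x / 2 = 2 * y + u + (a - b) / 2 \<longleftrightarrow> x = a + 4 * y + 2 * u - b" for x y u a b :: complex
      by (auto simp: field_simps)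
    ultimately show ?thesis unfolding dp[OF that] by (simp only: mult.assoc)
  qed
  ultimately show ?thesis unfolding FN_system_def PII_equation_def by blast
qed

section \<open>The zero-curvature equation of the Flaschka-Newell pair\<close>

lemma mat22_nth:
  "mat22 a b c d $ 1 $ 1 = a" "mat22 a b c d $ 1 $ 2 = b"
  "mat22 a b c d $ 2 $ 1 = c" "mat22 a b c d $ 2 $ 2 = d"
  by (simp_all add: mat22_def)

lemma FN_A_eq: "FN_A \<theta> p q z t =
    mat22 (p t / z) (((p t)\<^sup>2 - \<theta>\<^sup>2 / 4) / q t / z + q t + t + z) (1 - q t / z) (- p t / z)"
  by (simp add: FN_A_def FN_A0_def FN_A1_def FN_A2_def vec_eq_iff forall_2 mat22_nth map_matrix_def)

lemma FN_B_eq: "FN_B q z t = mat22 0 (2 * q t + t + z) 1 0"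
  by (simp add: FN_B_def vec_eq_iff forall_2 mat22_nth map_matrix_def)

lemma mat22_eq_iff: "mat22 a b c d = mat22 a' b' c' d' \<longleftrightarrow> a = a' \<and> b = b' \<and> c = c' \<and> d = d'"
  by (auto simp: vec_eq_iff forall_2 mat22_nth)

lemma FN_commute_iff_system:
  assumes U: "open U" and p: "p holomorphic_on U" and q: "q holomorphic_on U"
    and q0: "\<And>t. t \<in> U \<Longrightarrow> q t \<noteq> 0"
  shows "commute_on ((UNIV - {0}) \<times> U) (dz_op (FN_A \<theta> p q)) (dt_op (FN_B q)) \<longleftrightarrow> FN_system \<theta> U p q"
proof -
  define R where "R t = ((p t)\<^sup>2 - \<theta>\<^sup>2 / 4) / q t" for t
  \<comment> \<open>Obtained by differentiating
    \<open>R t * q t = (p t)\<^sup>2 - \<theta>\<^sup>2 / 4\<close> and solving for the derivative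
    of \<open>R\<close>.\<close>
  define R' where "R' t = (2 * p t * deriv p t - R t * deriv q t) / q t" for t
  define A' where "A' z t = mat22 (deriv p t / z) (R' t / z + deriv q t + 1) (- deriv q t / z) (- deriv p t / z)"
    for z t
  define B' where "B' = mat22 0 1 0 0"
  have dp: "(p has_field_derivative deriv p t) (at t)" and dq: "(q has_field_derivative deriv q t) (at t)"
    if "t \<in> U" for t using holomorphic_derivI[OF _ U that] p q by auto
  have dR: "(R has_field_derivative R' t) (at t)" if "t \<in> U" for t
    unfolding R_def[abs_def] R'_def using q0[OF that]
    by (auto intro!: derivative_eq_intros dp dq that simp: field_simps R_def power2_eq_square)
  have A: "((\<lambda>s. FN_A \<theta> p q z s $ i $ j) has_field_derivative A' z t $ i $ j) (at t)"
    if "(z, t) \<in> (UNIV - {0}) \<times> U" for z t i j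
    using that exhaust_2[of i] exhaust_2[of j] unfolding FN_A_eq A'_def R_def[symmetric]
    by (auto simp: mat22_nth intro!: derivative_eq_intros dp dq dR)
  have B: "((\<lambda>w. FN_B q w t $ i $ j) has_field_derivative B' $ i $ j) (at z)" for z t i j
    using exhaust_2[of i] exhaust_2[of j] unfolding FN_B_eq B'_def
    by (auto simp: mat22_nth intro!: derivative_eq_intros)
  \<comment> \<open>On the diagonal the parts polynomial in \<open>z\<close> cancel, leaving a
    multiple of \<open>1 / z\<close>. The summand \<open>2 * p t\<close> in the upper right comes
    from the pole of \<open>FN_A\<close> meeting the linear term of \<open>FN_B\<close>.\<close>
  have curv: "B' + FN_A \<theta> p q z t ** FN_B q z t - FN_B q z t ** FN_A \<theta> p q z t =
      mat22 ((R t + 2 * (q t)\<^sup>2 + t * q t) / z) (1 + 2 * p t * (2 * q t + t) / z + 2 * p t)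
        (- 2 * p t / z) (- (R t + 2 * (q t)\<^sup>2 + t * q t) / z)" if "z \<noteq> 0" for z t
    using that unfolding FN_A_eq FN_B_eq B'_def R_def[symmetric]
    by (simp add: vec_eq_iff forall_2 mat22_nth matrix_matrix_mult_def sum_2)
      (simp add: field_simps power2_eq_square)
  have pt: "A' z t = B' + FN_A \<theta> p q z t ** FN_B q z t - FN_B q z t ** FN_A \<theta> p q z t \<longleftrightarrow>
      deriv q t = 2 * p t \<and> deriv p t = 2 * (q t)\<^sup>2 + t * q t + R t" if "z \<noteq> 0" "t \<in> U" for z t
  proof -
    \<comment> \<open>The \<open>1 / z\<close> part of the upper right entry: on solutions the terms
      with \<open>R t\<close> cancel in the numerator of \<open>R' t\<close>, and the rest is
      divisible by \<open>q t\<close>. The part free of \<open>z\<close> is the first differential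
      equation.\<close>
    have "R' t = 2 * p t * (2 * q t + t)"
      if "deriv q t = 2 * p t" "deriv p t = 2 * (q t)\<^sup>2 + t * q t + R t"
      unfolding R'_def that using q0[OF \<open>t \<in> U\<close>] by (simp add: field_simps power2_eq_square)
    then show ?thesis
      unfolding curv[OF that(1)] A'_def mat22_eq_iff using that(1) by (auto simp: field_simps)
  qed
  have "open ((UNIV - {0::complex}) \<times> U)"
    using U by (intro open_Times) (auto intro: open_delete)
  from commute_on_iff_zero_curvature[where A = "FN_A \<theta> p q" and B = "FN_B q"
      and A' = A' and B' = "\<lambda>_ _. B'", OF this A B]
  have "commute_on ((UNIV - {0}) \<times> U) (dz_op (FN_A \<theta> p q)) (dt_op (FN_B q)) \<longleftrightarrow>
      (\<forall>(z, t)\<in>(UNIV - {0}) \<times> U.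
        A' z t = B' + FN_A \<theta> p q z t ** FN_B q z t - FN_B q z t ** FN_A \<theta> p q z t)" .
  also have "\<dots> \<longleftrightarrow> (\<forall>(z, t)\<in>(UNIV - {0 :: complex}) \<times> U.
      deriv q t = 2 * p t \<and> deriv p t = 2 * (q t)\<^sup>2 + t * q t + R t)"
    by (intro ball_cong) (auto simp: pt)
  \<comment> \<open>The point \<open>z = 1\<close> shows that the range of \<open>z\<close> is
    nonempty, so the statement free of \<open>z\<close> can be extracted.\<close>
  also have "\<dots> \<longleftrightarrow> FN_system \<theta> U p q"
    unfolding FN_system_def R_def using one_neq_zero[where 'a = complex] by blast
  finally show ?thesis .
qed

theorem mainTheorem17:
  fixes \<theta> :: complex and p q :: "complex \<Rightarrow> complex" and U :: "complex set"
  assumes "open U" and "connected U"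
    and "p holomorphic_on U" and "q holomorphic_on U"
    and "\<And>t. t \<in> U \<Longrightarrow> q t \<noteq> 0"
  shows "(commute_on ((UNIV - {0}) \<times> U) (dz_op (FN_A \<theta> p q)) (dt_op (FN_B q)) \<longleftrightarrow> FN_system \<theta> U p q)
    \<and> (\<forall>P Q t. Q \<noteq> 0 \<longrightarrow>
          ham_q (FN_H \<theta>) P Q t = 2 * P \<and>
          ham_p (FN_H \<theta>) P Q t = 2 * Q\<^sup>2 + t * Q + (P\<^sup>2 - \<theta>\<^sup>2 / 4) / Q)
    \<and> (FN_system \<theta> U p q \<longleftrightarrow> hamiltonian_system (FN_H \<theta>) U p q)
    \<and> (FN_system \<theta> U p q \<longleftrightarrow> (\<forall>t\<in>U. p t = 1 / 2 * deriv q t) \<and> PII_equation \<theta> U q)"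
  using FN_commute_iff_system[OF assms(1,3,4,5)] FN_system_iff_hamiltonian[OF assms(5)]
    FN_system_iff_PII[OF assms(1,4,5)]
  by (simp add: ham_q_FN ham_p_FN)

end
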